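(* Let $C$ be an $n$-computad and let $x,\tilde x\in\mathrm{Tree}_n^{\mathcal O,\mathcal E}(C)$ be compatible trees which are both in normal form. If $x\sim\tilde x$, then $x=\tilde x$.
   Context: Trees. Fix an integer $n\ge 0$. For an $n$-graded set $X=(X_0,\dots,X_n)$, the $n$-graded set $\mathrm{Tree}_n^{\mathcal O}(X)$ consists of formal terms (labelled rooted trees): each $c\in X_k$ is a tree of dimension $k$ (a leaf, height $0$); if $x$ is a tree of dimension $i-1$ ($1\le i\le n$) then $u_i(x)$ is a tree of dimension $i$; if $x,y$ are trees of dimensions $i,j$ ($1\le i,j\le n$) then $\circ_{i,j}(x,y)$ is a tree of dimension $\max\{i,j\}$. Internal vertices are labelled by the symbols $u_i$, $\circ_{i,j}$; edges point towards the root. Computads, compatible trees and the relation $\sim$ are defined by mutual induction on dimension. For $0\le k\le n$, a $k$-computad $C$ consists of sets $C_0,\dots,C_k$ (cells) and maps $s,t:C_i\to \mathrm{Tree}_n^{\mathcal O,\mathcal E}(C_{\le i-1})_{i-1}$ for $1\le i\le k$ (values are compatible trees) with $ss(x)\sim st(x)$ and $ts(x)\sim tt(x)$ for $x\in C_i$, $i\ge 2$. Here $C_{\leq i-1}$ is the underlying $(i-1)$-computad. Source and target are extended to $s,t:\mathrm{Tree}_n^{\mathcal O}(C)_i\to\mathrm{Tree}_n^{\mathcal O}(C)_{i-1}$ by $s(u_i(x))=t(u_i(x))=x$; $s(\circ_{i,i}(x,y))=s(y)$, $t(\circ_{i,i}(x,y))=t(x)$; and for $j<i$: $s(\circ_{j,i}(x,y))=\circ_{j,i-1}(x,s(y))$,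 $s(\circ_{i,j}(x,y))=\circ_{i-1,j}(s(x),y)$, and likewise with $t$ in place of $s$. Compatible trees: leaves are compatible; $u_i(x)$ is compatible iff $x$ is; $\circ_{i,j}(x,y)$ is compatible iff $x,y$ are and $s^{i-m+1}(x)\sim t^{j-m+1}(y)$ with $m=\min\{i,j\}$. $\mathrm{Tree}_n^{\mathcal O,\mathcal E}(C)$ is the set of compatible trees. The relation $\sim$ (written $\stackrel{\epsilon}{=}$ in the paper) is the smallest dimensionwise equivalence relation on compatible trees which is a congruence (if $x\sim\tilde x$ and $y\sim\tilde y$ then $u_i(x)\sim u_i(\tilde x)$ and $\circ_{i,j}(x,y)\sim\circ_{i,j}(\tilde x,\tilde y)$ whenever these are compatible) and contains the following, for all trees of appropriate dimensions whenever the left-hand side is compatible: for $i\le k$: $\circ_{i,k}(u_i(x),y)\sim y$; $\circ_{k,i}(x,u_i(y))\sim x$; for $i<k$: $\circ_{i,k}(x,u_k(y))\sim u_k(\circ_{i,k-1}(x,y))$; $\circ_{k,i}(u_k(x),y)\sim u_k(\circ_{k-1,i}(x,y))$; $\circ_{k,k}(\circ_{k,k}(x,y),z)\sim\circ_{k,k}(x,\circ_{k,k}(y,z))$; for $i<k$: $\circ_{i,k}(\circ_{i,i}(x,y),z)\sim\circ_{i,k}(x,\circ_{i,k}(y,z))$; $\circ_{k,i}(\circ_{i,k}(x,y),z)\sim\circ_{i,k}(x,\circ_{k,i}(y,z))$; $\circ_{k,i}(\circ_{k,i}(x,y),z)\sim\circ_{k,i}(x,\circ_{i,i}(y,z))$;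 $\circ_{i,k}(x,\circ_{k,k}(y,z))\sim\circ_{k,k}(\circ_{i,k}(x,y),\circ_{i,k}(x,z))$; $\circ_{k,i}(\circ_{k,k}(x,y),z)\sim\circ_{k,k}(\circ_{k,i}(x,z),\circ_{k,i}(y,z))$; for $i<j<k$: $\circ_{i,k}(x,\circ_{j,k}(y,z))\sim\circ_{j,k}(\circ_{i,j}(x,y),\circ_{i,k}(x,z))$; $\circ_{i,k}(x,\circ_{k,j}(y,z))\sim\circ_{k,j}(\circ_{i,k}(x,y),\circ_{i,j}(x,z))$; $\circ_{k,i}(\circ_{j,k}(x,y),z)\sim\circ_{j,k}(\circ_{j,i}(x,z),\circ_{k,i}(y,z))$; $\circ_{k,i}(\circ_{k,j}(x,y),z)\sim\circ_{k,j}(\circ_{k,i}(x,z),\circ_{j,i}(y,z))$. (Under these conditions both sides are compatible, and $s,t$ respect $\sim$.) Normal forms. For a vertex $v$ labelled $\circ_{i,j}$ put $m(v)=\min\{i,j\}$. A tree is $m$-ordered if $m(v)\le m(w)$ for every edge $v\to w$ (pointing towards the root) between $\circ$-labelled vertices. An $m$-constant component of a tree is a maximal connected set of $\circ$-labelled internal vertices such that $m(v)=m(w)$ for every edge $v\to w$ within it. An $m$-constant component is in normal form if it is either (1) for some $i<k$, a chain starting at its root with $a\geq 0$ vertices labelled $\circ_{i,k}$, followed by $b\ge 0$ vertices labelled $\circ_{k,i}$ ($a+b\ge1$), in which the next vertex is always attached at the right input of a $\circ_{i,k}$ vertex and at the left input of a $\circ_{k,i}$ vertex, i.e. of the shape $\circ_{i,k}(\cdot,\dots\circ_{i,k}(\cdot,\circ_{k,i}(\dots\circ_{k,i}(\cdot,\cdot)\dots,\cdot))\dots)$;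 or (2) a chain of $\circ_{k,k}$'s each attached at the left input of the previous one, $\circ_{k,k}(\dots\circ_{k,k}(\cdot,\cdot)\dots,\cdot)$. A tree is in normal form if it is $m$-ordered, contains no edge from a $u$-labelled vertex to a $\circ$-labelled vertex (i.e. no $u_i(\cdot)$ is a direct input of a $\circ$), and each of its $m$-constant components is in normal form. *)

theory Defs
  imports Main
begin

text \<open>
  A leaf records the dimension of its cell, so the sets \<open>X k\<close> of a graded set \<open>X\<close> need not be
  disjoint. The constructors \<open>U\<close> and \<open>Comp\<close> stand for $u_i$ and $\circ_{i,j}$.
\<close>

datatype 'c tree =
    Leaf nat 'c
  | U nat "'c tree"
  | Comp nat nat "'c tree" "'c tree"

text \<open>\<open>is_tree n X d x\<close>: \<open>x\<close> is a tree of dimension \<open>d\<close> over the \<open>n\<close>-graded set \<open>X 0, \<dots>, X n\<close>.\<close>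

inductive is_tree :: "nat \<Rightarrow> (nat \<Rightarrow> 'c set) \<Rightarrow> nat \<Rightarrow> 'c tree \<Rightarrow> bool" for n X where
  "k \<le> n \<Longrightarrow> c \<in> X k \<Longrightarrow> is_tree n X k (Leaf k c)"
| "1 \<le> i \<Longrightarrow> i \<le> n \<Longrightarrow> is_tree n X (i - 1) x \<Longrightarrow> is_tree n X i (U i x)"
| "1 \<le> i \<Longrightarrow> i \<le> n \<Longrightarrow> 1 \<le> j \<Longrightarrow> j \<le> n \<Longrightarrow> is_tree n X i x \<Longrightarrow> is_tree n X j y
    \<Longrightarrow> is_tree n X (max i j) (Comp i j x y)"

text \<open>
  Only the values of \<open>src_cell C i\<close> and \<open>tgt_cell C i\<close> on \<open>cells C i\<close>, for \<open>i \<ge> 1\<close>, are meaningful.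
  The axioms of a computad are imposed by \<open>is_computad\<close> below; compatibility and the relation
  \<open>sim\<close> make sense for the bare data.
\<close>

record 'c computad_data =
  cells :: "nat \<Rightarrow> 'c set"
  src_cell :: "nat \<Rightarrow> 'c \<Rightarrow> 'c tree"
  tgt_cell :: "nat \<Rightarrow> 'c \<Rightarrow> 'c tree"

definition truncate_data :: "nat \<Rightarrow> 'c computad_data \<Rightarrow> 'c computad_data" where
  "truncate_data k C = C\<lparr>cells := (\<lambda>i. if i \<le> k then cells C i else {})\<rparr>"

text \<open>The values of \<open>src\<close> and \<open>tgt\<close> on trees of dimension 0 are meaningless.\<close>

primrec src :: "'c computad_data \<Rightarrow> 'c tree \<Rightarrow> 'c tree" where
  "src C (Leaf k c) = src_cell C k c"
| "src C (U i x) = x"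
| "src C (Comp i j x y) =
    (if i = j then src C y
     else if i < j then Comp i (j - 1) x (src C y)
     else Comp (i - 1) j (src C x) y)"

primrec tgt :: "'c computad_data \<Rightarrow> 'c tree \<Rightarrow> 'c tree" where
  "tgt C (Leaf k c) = tgt_cell C k c"
| "tgt C (U i x) = x"
| "tgt C (Comp i j x y) =
    (if i = j then tgt C x
     else if i < j then Comp i (j - 1) x (tgt C y)
     else Comp (i - 1) j (tgt C x) y)"

text \<open>
  The definition by induction on the dimension is rendered as one simultaneous inductive definition:
  compatibility of \<open>Comp i j x y\<close> refers to \<open>sim\<close> only in dimension \<open>min i j - 1\<close>, which is smaller
  than the dimension \<open>max i j\<close> of that tree, and \<open>sim\<close> in dimension \<open>d\<close> refers to both notions only
  in dimensions up to \<open>d\<close>. In the rules for \<open>sim\<close>, compatibility of the left-hand side forces the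
  arguments to have the appropriate dimensions, and \<open>1 \<le> i\<close>.
\<close>

inductive
  compatible :: "nat \<Rightarrow> 'c computad_data \<Rightarrow> 'c tree \<Rightarrow> bool" and
  sim :: "nat \<Rightarrow> 'c computad_data \<Rightarrow> 'c tree \<Rightarrow> 'c tree \<Rightarrow> bool"
  for n C
where
  compatible_Leaf: "is_tree n (cells C) k (Leaf k c) \<Longrightarrow> compatible n C (Leaf k c)"
| compatible_U: "is_tree n (cells C) i (U i x) \<Longrightarrow> compatible n C x \<Longrightarrow> compatible n C (U i x)"
| compatible_Comp: "is_tree n (cells C) (max i j) (Comp i j x y) \<Longrightarrow> compatible n C x \<Longrightarrow> compatible n C y
    \<Longrightarrow> sim n C ((src C ^^ (i - min i j + 1)) x) ((tgt C ^^ (j - min i j + 1)) y)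
    \<Longrightarrow> compatible n C (Comp i j x y)"

| sim_refl: "compatible n C x \<Longrightarrow> sim n C x x"
| sim_sym: "sim n C x y \<Longrightarrow> sim n C y x"
| sim_trans: "sim n C x y \<Longrightarrow> sim n C y z \<Longrightarrow> sim n C x z"
| sim_U: "sim n C x x' \<Longrightarrow> compatible n C (U i x) \<Longrightarrow> compatible n C (U i x')
    \<Longrightarrow> sim n C (U i x) (U i x')"
| sim_Comp: "sim n C x x' \<Longrightarrow> sim n C y y' \<Longrightarrow> compatible n C (Comp i j x y)
    \<Longrightarrow> compatible n C (Comp i j x' y') \<Longrightarrow> sim n C (Comp i j x y) (Comp i j x' y')"

| sim_unit_left: "i \<le> k \<Longrightarrow> compatible n C (Comp i k (U i x) y)
    \<Longrightarrow> sim n C (Comp i k (U i x) y) y"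
| sim_unit_right: "i \<le> k \<Longrightarrow> compatible n C (Comp k i x (U i y))
    \<Longrightarrow> sim n C (Comp k i x (U i y)) x"
| sim_whisker_unit_left: "i < k \<Longrightarrow> compatible n C (Comp i k x (U k y))
    \<Longrightarrow> sim n C (Comp i k x (U k y)) (U k (Comp i (k - 1) x y))"
| sim_whisker_unit_right: "i < k \<Longrightarrow> compatible n C (Comp k i (U k x) y)
    \<Longrightarrow> sim n C (Comp k i (U k x) y) (U k (Comp (k - 1) i x y))"

| sim_assoc: "compatible n C (Comp k k (Comp k k x y) z)
    \<Longrightarrow> sim n C (Comp k k (Comp k k x y) z) (Comp k k x (Comp k k y z))"
| sim_assoc_iik: "i < k \<Longrightarrow> compatible n C (Comp i k (Comp i i x y) z)
    \<Longrightarrow> sim n C (Comp i k (Comp i i x y) z) (Comp i k x (Comp i k y z))"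
| sim_assoc_iki: "i < k \<Longrightarrow> compatible n C (Comp k i (Comp i k x y) z)
    \<Longrightarrow> sim n C (Comp k i (Comp i k x y) z) (Comp i k x (Comp k i y z))"
| sim_assoc_kii: "i < k \<Longrightarrow> compatible n C (Comp k i (Comp k i x y) z)
    \<Longrightarrow> sim n C (Comp k i (Comp k i x y) z) (Comp k i x (Comp i i y z))"
| sim_distrib_ikk: "i < k \<Longrightarrow> compatible n C (Comp i k x (Comp k k y z))
    \<Longrightarrow> sim n C (Comp i k x (Comp k k y z)) (Comp k k (Comp i k x y) (Comp i k x z))"
| sim_distrib_kki: "i < k \<Longrightarrow> compatible n C (Comp k i (Comp k k x y) z)
    \<Longrightarrow> sim n C (Comp k i (Comp k k x y) z) (Comp k k (Comp k i x z) (Comp k i y z))"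

| sim_distrib_ijk: "i < j \<Longrightarrow> j < k \<Longrightarrow> compatible n C (Comp i k x (Comp j k y z))
    \<Longrightarrow> sim n C (Comp i k x (Comp j k y z)) (Comp j k (Comp i j x y) (Comp i k x z))"
| sim_distrib_ikj: "i < j \<Longrightarrow> j < k \<Longrightarrow> compatible n C (Comp i k x (Comp k j y z))
    \<Longrightarrow> sim n C (Comp i k x (Comp k j y z)) (Comp k j (Comp i k x y) (Comp i j x z))"
| sim_distrib_jki: "i < j \<Longrightarrow> j < k \<Longrightarrow> compatible n C (Comp k i (Comp j k x y) z)
    \<Longrightarrow> sim n C (Comp k i (Comp j k x y) z) (Comp j k (Comp j i x z) (Comp k i y z))"
| sim_distrib_kji: "i < j \<Longrightarrow> j < k \<Longrightarrow> compatible n C (Comp k i (Comp k j x y) z)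
    \<Longrightarrow> sim n C (Comp k i (Comp k j x y) z) (Comp k j (Comp k i x z) (Comp j i y z))"

definition compatible_trees :: "nat \<Rightarrow> 'c computad_data \<Rightarrow> nat \<Rightarrow> 'c tree set" where
  "compatible_trees n C d = {x. is_tree n (cells C) d x \<and> compatible n C x}"

text \<open>
  \<open>is_computad n k C\<close>: \<open>C\<close> is a \<open>k\<close>-computad, for \<open>k \<le> n\<close>. It is regarded as having no cells above
  dimension \<open>k\<close>.
\<close>

definition is_computad :: "nat \<Rightarrow> nat \<Rightarrow> 'c computad_data \<Rightarrow> bool" where
  "is_computad n k C \<longleftrightarrow>
     k \<le> n \<and> (\<forall>i>k. cells C i = {}) \<and>
     (\<forall>i. 1 \<le> i \<and> i \<le> k \<longrightarrow> (\<forall>c \<in> cells C i.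
        src_cell C i c \<in> compatible_trees n (truncate_data (i - 1) C) (i - 1) \<and>
        tgt_cell C i c \<in> compatible_trees n (truncate_data (i - 1) C) (i - 1) \<and>
        (2 \<le> i \<longrightarrow>
           sim n (truncate_data (i - 1) C) (src C (src_cell C i c)) (src C (tgt_cell C i c)) \<and>
           sim n (truncate_data (i - 1) C) (tgt C (src_cell C i c)) (tgt C (tgt_cell C i c)))))"

text \<open>
  A vertex of a tree is addressed by the path of inputs leading to it from the root. The edge from a
  vertex \<open>v\<close> towards the root ends at \<open>w\<close> iff \<open>v = w @ [d]\<close> for some input \<open>d\<close>.
\<close>

datatype input = In_U | In_Left | In_Right

type_synonym vertex = "input list"

fun subtree_at :: "'c tree \<Rightarrow> vertex \<Rightarrow> 'c tree option" where
  "subtree_at x [] = Some x"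
| "subtree_at (U i x) (In_U # v) = subtree_at x v"
| "subtree_at (Comp i j x y) (In_Left # v) = subtree_at x v"
| "subtree_at (Comp i j x y) (In_Right # v) = subtree_at y v"
| "subtree_at _ _ = None"

definition u_vertices :: "'c tree \<Rightarrow> vertex set" where
  "u_vertices x = {v. \<exists>i y. subtree_at x v = Some (U i y)}"

definition labelled_comp :: "'c tree \<Rightarrow> vertex \<Rightarrow> nat \<Rightarrow> nat \<Rightarrow> bool" where
  "labelled_comp x v i j \<longleftrightarrow> (\<exists>y z. subtree_at x v = Some (Comp i j y z))"

definition comp_vertices :: "'c tree \<Rightarrow> vertex set" where
  "comp_vertices x = {v. \<exists>i j. labelled_comp x v i j}"

definition edge :: "vertex \<Rightarrow> vertex \<Rightarrow> bool" where
  "edge v w \<longleftrightarrow> (\<exists>d. v = w @ [d])"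

text \<open>The value of \<open>m_val x v\<close> is meaningless unless \<open>v \<in> comp_vertices x\<close>.\<close>

definition m_val :: "'c tree \<Rightarrow> vertex \<Rightarrow> nat" where
  "m_val x v = (case subtree_at x v of Some (Comp i j y z) \<Rightarrow> min i j | _ \<Rightarrow> 0)"

definition m_ordered :: "'c tree \<Rightarrow> bool" where
  "m_ordered x \<longleftrightarrow>
     (\<forall>v \<in> comp_vertices x. \<forall>w \<in> comp_vertices x. edge v w \<longrightarrow> m_val x v \<le> m_val x w)"

definition connected_vertices :: "vertex set \<Rightarrow> bool" where
  "connected_vertices S \<longleftrightarrow> S \<noteq> {} \<and>
     (\<forall>v \<in> S. \<forall>w \<in> S. (v, w) \<in> {(a, b). a \<in> S \<and> b \<in> S \<and> (edge a b \<or> edge b a)}\<^sup>*)"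

definition m_constant_connected :: "'c tree \<Rightarrow> vertex set \<Rightarrow> bool" where
  "m_constant_connected x S \<longleftrightarrow> S \<subseteq> comp_vertices x \<and> connected_vertices S \<and>
     (\<forall>v \<in> S. \<forall>w \<in> S. edge v w \<longrightarrow> m_val x v = m_val x w)"

definition m_constant_component :: "'c tree \<Rightarrow> vertex set \<Rightarrow> bool" where
  "m_constant_component x S \<longleftrightarrow> m_constant_connected x S \<and>
     (\<forall>T. m_constant_connected x T \<and> S \<subseteq> T \<longrightarrow> T = S)"

text \<open>In both shapes, \<open>v 0, v 1, \<dots>\<close> is the chain of vertices, starting at the root of the component.\<close>

definition mixed_chain :: "'c tree \<Rightarrow> vertex set \<Rightarrow> bool" where
  "mixed_chain x S \<longleftrightarrow> (\<exists>i k a b. \<exists>v :: nat \<Rightarrow> vertex.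
     i < k \<and> 1 \<le> a + b \<and> S = v ` {..<a + b} \<and>
     (\<forall>l < a. labelled_comp x (v l) i k) \<and>
     (\<forall>l. a \<le> l \<and> l < a + b \<longrightarrow> labelled_comp x (v l) k i) \<and>
     (\<forall>l. l + 1 < a + b \<longrightarrow> v (l + 1) = v l @ [if l < a then In_Right else In_Left]))"

definition equal_chain :: "'c tree \<Rightarrow> vertex set \<Rightarrow> bool" where
  "equal_chain x S \<longleftrightarrow> (\<exists>k a. \<exists>v :: nat \<Rightarrow> vertex.
     1 \<le> a \<and> S = v ` {..<a} \<and>
     (\<forall>l < a. labelled_comp x (v l) k k) \<and>
     (\<forall>l. l + 1 < a \<longrightarrow> v (l + 1) = v l @ [In_Left]))"

definition normal_form :: "'c tree \<Rightarrow> bool" where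
  "normal_form x \<longleftrightarrow>
     m_ordered x \<and>
     (\<forall>v \<in> u_vertices x. \<forall>w \<in> comp_vertices x. \<not> edge v w) \<and>
     (\<forall>S. m_constant_component x S \<longrightarrow> mixed_chain x S \<or> equal_chain x S)"

end

theory Submission
  imports Defs
begin

text \<open>
  Trees are evaluated strictly in a model that forgets units. Fully distributed, a tree of dimension
  \<open>d\<close> built without units is a list of atoms; an atom is a cell together with, for each level
  \<open>m < d\<close>, the lists of \<open>m\<close>-dimensional atoms whiskered onto it along dimension \<open>m - 1\<close> from the left
  and from the right. Composition is concatenation or whiskering, so that associativity and
  distributivity hold on the nose. A unit has the value of its argument: only the dimension of the
  value drops, and a value of dimension below \<open>m\<close> is neutral for composition at level \<open>m\<close>. Two such
  neutral values must agree for both unit laws to hold; they do because iterated sources and targets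
  of a tree with value of low dimension have the same value, so compatibility makes them equal.
  Hence \<open>\<sim>\<close> preserves values. Conversely, units occur in a normal form only at the root, and
  the rest of a normal form, hence all of it given its dimension, can be read off from its value.
\<close>

section \<open>Atoms, whiskering and composition of values\<close>

datatype 'c atom = Atom 'c "nat \<Rightarrow> 'c atom list" "nat \<Rightarrow> 'c atom list"

lemma atom_induct [case_names Atom]:
  assumes "\<And>c L R. (\<And>j b. b \<in> set (L j) \<Longrightarrow> P b) \<Longrightarrow> (\<And>j b. b \<in> set (R j) \<Longrightarrow> P b) \<Longrightarrow> P (Atom c L R)"
  shows "P a"
  by (induction a) (metis assms rangeI)

text \<open>Whiskers at higher levels lie further out. A new one at level \<open>m\<close> leaves
  those below untouched, is added at the outer end of the list at level \<open>m\<close>, and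
  distributes over those above, whose atoms are whiskered recursively.\<close>

primrec lwhisk :: "nat \<Rightarrow> 'c atom list \<Rightarrow> 'c atom \<Rightarrow> 'c atom" where
  "lwhisk m l (Atom c L R) = Atom c
     (\<lambda>j. if j < m then L j else if j = m then l @ L j else map (lwhisk m l) (L j))
     (\<lambda>j. if j \<le> m then R j else map (lwhisk m l) (R j))"

primrec rwhisk :: "nat \<Rightarrow> 'c atom list \<Rightarrow> 'c atom \<Rightarrow> 'c atom" where
  "rwhisk m l (Atom c L R) = Atom c
     (\<lambda>j. if j \<le> m then L j else map (rwhisk m l) (L j))
     (\<lambda>j. if j < m then R j else if j = m then R j @ l else map (rwhisk m l) (R j))"

text \<open>The identities at a single level \<open>m\<close> render the associativity laws for
  \<open>i < k\<close>; those with \<open>i < j\<close> below render the distributivity laws for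
  \<open>i < j < k\<close>.\<close>

lemma lwhisk_append: "lwhisk m l (lwhisk m l' a) = lwhisk m (l @ l') a"
  by (induction a rule: atom_induct) (auto simp: fun_eq_iff)

lemma rwhisk_append: "rwhisk m l (rwhisk m l' a) = rwhisk m (l' @ l) a"
  by (induction a rule: atom_induct) (auto simp: fun_eq_iff)

lemma lwhisk_rwhisk_commute: "rwhisk m l (lwhisk m l' a) = lwhisk m l' (rwhisk m l a)"
  by (induction a rule: atom_induct) (auto simp: fun_eq_iff)

lemma lwhisk_lwhisk:
  "i < j \<Longrightarrow> lwhisk i l (lwhisk j l' a) = lwhisk j (map (lwhisk i l) l') (lwhisk i l a)"
  by (induction a rule: atom_induct) (auto simp: fun_eq_iff)

lemma lwhisk_rwhisk:
  "i < j \<Longrightarrow> lwhisk i l (rwhisk j l' a) = rwhisk j (map (lwhisk i l) l') (lwhisk i l a)"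
  by (induction a rule: atom_induct) (auto simp: fun_eq_iff)

lemma rwhisk_lwhisk:
  "i < j \<Longrightarrow> rwhisk i l (lwhisk j l' a) = lwhisk j (map (rwhisk i l) l') (rwhisk i l a)"
  by (induction a rule: atom_induct) (auto simp: fun_eq_iff)

lemma rwhisk_rwhisk:
  "i < j \<Longrightarrow> rwhisk i l (rwhisk j l' a) = rwhisk j (map (rwhisk i l) l') (rwhisk i l a)"
  by (induction a rule: atom_induct) (auto simp: fun_eq_iff)

text \<open>
  The first component is the dimension of a value. The last case gives junk when both dimensions
  exceed \<open>m\<close>, which does not happen for \<open>m = min i j\<close>. If both arguments are neutral, the second one
  is returned, an arbitrary choice.
\<close>

fun vcomp :: "nat \<Rightarrow> nat \<times> 'c atom list \<Rightarrow> nat \<times> 'c atom list \<Rightarrow> nat \<times> 'c atom list" where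
  "vcomp m (d, l) (e, l') =
     (if d < m then (e, l') else if e < m then (d, l)
      else (max d e,
        if d = m \<and> e = m then l @ l' else if d = m then map (lwhisk m l) l' else map (rwhisk m l') l))"

text \<open>At most one dimension above \<open>m\<close> keeps every composite out of the junk case
  and still covers all four associativity laws.\<close>

lemma vcomp_assoc:
  assumes "fst u \<le> m \<and> fst v \<le> m \<or> fst u \<le> m \<and> fst w \<le> m \<or> fst v \<le> m \<and> fst w \<le> m"
  shows "vcomp m (vcomp m u v) w = vcomp m u (vcomp m v w)"
  using assms by (cases u; cases v; cases w)
    (auto simp: max_def lwhisk_append rwhisk_append lwhisk_rwhisk_commute)

text \<open>If \<open>v\<close> or \<open>w\<close> is neutral at level \<open>j\<close>, it stays
  so after composition with \<open>u\<close>, whose dimension is below \<open>j\<close>. The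
  remaining cases are immediate or reduce to the identities for atoms.\<close>

lemma vcomp_ldistrib:
  assumes "i < j" "fst u \<le> i" "fst v \<le> j \<or> fst w \<le> j"
  shows "vcomp i u (vcomp j v w) = vcomp j (vcomp i u v) (vcomp i u w)"
  using assms by (cases u; cases v; cases w)
    (auto simp: max_def lwhisk_lwhisk lwhisk_rwhisk)

lemma vcomp_rdistrib:
  assumes "i < j" "fst w \<le> i" "fst u \<le> j \<or> fst v \<le> j"
  shows "vcomp i (vcomp j u v) w = vcomp j (vcomp i u w) (vcomp i v w)"
  using assms by (cases u; cases v; cases w)
    (auto simp: max_def rwhisk_lwhisk rwhisk_rwhisk)

section \<open>Evaluation of trees and its invariance under \<open>sim\<close>\<close>

primrec val :: "'c tree \<Rightarrow> nat \<times> 'c atom list" where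
  "val (Leaf k c) = (k, [Atom c (\<lambda>_. []) (\<lambda>_. [])])"
| "val (U i x) = val x"
| "val (Comp i j x y) = vcomp (min i j) (val x) (val y)"

primrec tdim :: "'c tree \<Rightarrow> nat" where
  "tdim (Leaf k c) = k"
| "tdim (U i x) = i"
| "tdim (Comp i j x y) = max i j"

text \<open>Removes the arbitrariness in \<open>vcomp\<close>: where both arguments are neutral,
  either one may be returned. Compatible trees satisfy this by
  \<open>compatible_sim_val\<close>.\<close>

primrec units_agree :: "'c tree \<Rightarrow> bool" where
  "units_agree (Leaf k c) \<longleftrightarrow> True"
| "units_agree (U i x) \<longleftrightarrow> units_agree x"
| "units_agree (Comp i j x y) \<longleftrightarrow> units_agree x \<and> units_agree y \<and>
     (fst (val x) < min i j \<longrightarrow> fst (val y) < min i j \<longrightarrow> val x = val y)"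

inductive_simps is_tree_Leaf [simp]: "is_tree n X d (Leaf k c)"
inductive_simps is_tree_U [simp]: "is_tree n X d (U i x)"
inductive_simps is_tree_Comp [simp]: "is_tree n X d (Comp i j x y)"

lemma is_tree_tdim: "is_tree n X d x \<Longrightarrow> tdim x = d"
  by (induction rule: is_tree.induct) auto

lemma fst_vcomp: "fst (vcomp m u v) =
   (if fst u < m then fst v else if fst v < m then fst u else max (fst u) (fst v))"
  by (cases u; cases v) auto

lemma vcomp_degenerate: "fst u < m \<Longrightarrow> vcomp m u v = v"
   "\<not> fst u < m \<Longrightarrow> fst v < m \<Longrightarrow> vcomp m u v = u"
  by (cases u; cases v; simp)+

lemma fst_val_le: "is_tree n X d x \<Longrightarrow> fst (val x) \<le> d"
  by (induction rule: is_tree.induct) (auto simp: fst_vcomp)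

text \<open>
  The iterates are treated at once because a boundary of a tree need not inherit \<open>units_agree\<close>.
  Here \<open>s\<close> stands for \<open>src C\<close> or \<open>tgt C\<close>.
\<close>

lemma val_boundary_funpow:
  assumes U: "\<And>i x. s (U i x) = x"
    and less: "\<And>i j x y. i < j \<Longrightarrow> s (Comp i j x y) = Comp i (j - 1) x (s y)"
    and greater: "\<And>i j x y. j < i \<Longrightarrow> s (Comp i j x y) = Comp (i - 1) j (s x) y"
    and equal: "\<And>i x y. s (Comp i i x y) = s x \<or> s (Comp i i x y) = s y"
    and x: "is_tree n X d x" "units_agree x" "fst (val x) + r \<le> d"
  shows "val ((s ^^ r) x) = val x"
  using x
proof (induction arbitrary: r rule: is_tree.induct)
  case (1 k c)
  \<comment> \<open>A leaf has a value of full dimension, so \<open>r\<close> is 0.\<close>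
  then show ?case by simp
next
  case (2 i x)
  show ?case
  proof (cases r)
    case (Suc q)
    then have "(s ^^ r) (U i x) = (s ^^ q) x" by (simp add: U funpow_Suc_right del: funpow.simps)
    then show ?thesis using 2 Suc by simp
  qed simp
next
  case (3 i j x y)
  define m where "m = min i j"
  have pow_less: "(s ^^ q) (Comp a b u v) = Comp a (b - q) u ((s ^^ q) v)" if "q \<le> b - a" for q a b u v
    using that by (induction q) (auto simp: less)
  have pow_greater: "(s ^^ q) (Comp a b u v) = Comp (a - q) b ((s ^^ q) u) v" if "q \<le> a - b" for q a b u v
    using that by (induction q) (auto simp: greater)
  have le: "fst (val x) \<le> i" "fst (val y) \<le> j"
    using 3(5,6) by (auto dest: fst_val_le)
  \<comment> \<open>The first \<open>max i j - m\<close> steps act only on the factor of larger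
    dimension. After them both indices are equal, and the next step passes to one of the
    factors.\<close>
  show ?case
  proof (cases "r \<le> max i j - m")
    case True
    show ?thesis
    proof (cases "i \<le> j")
      case i: True
      \<comment> \<open>If the composite is \<open>val x\<close> because \<open>val y\<close> is
        neutral, the bound comes from \<open>fst (val y) < i\<close> and
        \<open>r \<le> j - i\<close> instead of the premise.\<close>
      have "fst (val y) + r \<le> j"
        using "3.prems"(2) True i le by (auto simp: fst_vcomp m_def split: if_splits)
      then have "val ((s ^^ r) y) = val y" using 3 by simp
      moreover have "r \<le> j - i" "i \<le> j - r" using True i by (auto simp: m_def)
      ultimately show ?thesis using i by (simp add: pow_less)
    next
      case i: False
      have "fst (val x) + r \<le> i"
        using "3.prems"(2) True i le by (auto simp: fst_vcomp m_def split: if_splits)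
      then have "val ((s ^^ r) x) = val x" using 3 by simp
      moreover have "r \<le> i - j" "j \<le> i - r" using True i by (auto simp: m_def)
      ultimately show ?thesis using i by (simp add: pow_greater)
    qed
  next
    case False
    define q where "q = r - (max i j - m) - 1"
    have r: "r = q + (1 + (max i j - m))" using False by (simp add: q_def)
    have deg: "fst (val x) < m" "fst (val y) < m"
      using "3.prems"(2) False by (auto simp: fst_vcomp m_def split: if_splits)
    with "3.prems"(1) have eq: "val x = val y" by (simp add: m_def)
    define z where "z = (s ^^ (max i j - m)) (Comp i j x y)"
    have z: "z = (if i \<le> j then Comp i i x ((s ^^ (j - i)) y) else Comp j j ((s ^^ (i - j)) x) y)"
      by (simp add: z_def m_def max_def min_def pow_less pow_greater)
    have "(s ^^ r) (Comp i j x y) = (s ^^ q) (s z)"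
      by (simp add: r funpow_add z_def funpow_swap1)
    moreover have "s z = (s ^^ (1 + (j - m))) y \<or> s z = (s ^^ (1 + (i - m))) x"
      using equal[of i x "(s ^^ (j - i)) y"] equal[of j "(s ^^ (i - j)) x" y]
      by (auto simp: z m_def min_def)
    ultimately have "(s ^^ r) (Comp i j x y) = (s ^^ (q + (1 + (j - m)))) y
        \<or> (s ^^ r) (Comp i j x y) = (s ^^ (q + (1 + (i - m)))) x"
      by (auto simp: funpow_add funpow_swap1)
    moreover have "fst (val y) + r \<le> max i j"
      using "3.prems"(2) eq deg by (simp add: vcomp_degenerate m_def)
    then have "fst (val y) + (q + (1 + (j - m))) \<le> j" "fst (val x) + (q + (1 + (i - m))) \<le> i"
      using r by (auto simp: eq m_def max_def min_def split: if_splits)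
    then have "val ((s ^^ (q + (1 + (j - m)))) y) = val y" "val ((s ^^ (q + (1 + (i - m)))) x) = val y"
      using 3(7)[of "q + (1 + (i - m))"] 3(8)[of "q + (1 + (j - m))"] "3.prems"(1) eq by simp_all
    ultimately have "val ((s ^^ r) (Comp i j x y)) = val y" by metis
    then show ?thesis using deg by (simp add: vcomp_degenerate m_def)
  qed
qed

lemma val_src_funpow:
  "is_tree n X d x \<Longrightarrow> units_agree x \<Longrightarrow> fst (val x) + r \<le> d \<Longrightarrow> val ((src C ^^ r) x) = val x"
  by (rule val_boundary_funpow) auto

lemma val_tgt_funpow:
  "is_tree n X d x \<Longrightarrow> units_agree x \<Longrightarrow> fst (val x) + r \<le> d \<Longrightarrow> val ((tgt C ^^ r) x) = val x"
  by (rule val_boundary_funpow) auto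

text \<open>Each claim feeds the other: equal values of the matching boundaries yield
  \<open>units_agree\<close>, which the right unit law uses. The dimension is carried along because
  the value does not determine it.\<close>

lemma compatible_sim_val:
  "compatible n C x \<Longrightarrow> is_tree n (cells C) (tdim x) x \<and> units_agree x"
  "sim n C x y \<Longrightarrow> tdim x = tdim y \<and> val x = val y"
proof (induction rule: compatible_sim.inducts)
  case (compatible_Comp i j x y)
  then have *: "is_tree n (cells C) i x" "is_tree n (cells C) j y" "units_agree x" "units_agree y" by auto
  \<comment> \<open>For neutral values, the numbers of boundary steps in the compatibility condition
    lie within the bounds of \<open>val_src_funpow\<close> and \<open>val_tgt_funpow\<close>, so the
    condition compares \<open>val x\<close> and \<open>val y\<close> themselves.\<close>
  have "val x = val y" if "fst (val x) < min i j" "fst (val y) < min i j"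
  proof -
    have "val ((src C ^^ (i - min i j + 1)) x) = val x"
      by (rule val_src_funpow[OF *(1,3)]) (use that in \<open>auto simp: min_def\<close>)
    moreover have "val ((tgt C ^^ (j - min i j + 1)) y) = val y"
      by (rule val_tgt_funpow[OF *(2,4)]) (use that in \<open>auto simp: min_def\<close>)
    ultimately show ?thesis using compatible_Comp by simp
  qed
  then show ?case using compatible_Comp * by auto
next
  case (sim_unit_left i k x y)
  then have "fst (val x) \<le> i - 1" by (auto dest: fst_val_le)
  then show ?case using sim_unit_left by (auto dest: is_tree_tdim simp: vcomp_degenerate)
next
  case (sim_unit_right i k x y)
  then have "fst (val y) \<le> i - 1" by (auto dest: fst_val_le)
  \<comment> \<open>If \<open>val x\<close> is neutral too, \<open>vcomp\<close> returns
    \<open>val y\<close>, which \<open>units_agree\<close> identifies with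
    \<open>val x\<close>.\<close>
  then show ?case using sim_unit_right
    by (cases "fst (val x) < i") (auto dest: is_tree_tdim simp: vcomp_degenerate)
next
  case (sim_whisker_unit_right i k x y)
  then have "min (k - 1) i = i" by simp
  then show ?case using sim_whisker_unit_right by auto
qed (auto simp: min_def max_def dest!: fst_val_le intro!: vcomp_assoc vcomp_ldistrib vcomp_rdistrib)


section \<open>From components of normal forms to conditions on single edges\<close>

primrec is_U :: "'c tree \<Rightarrow> bool" where
  "is_U (Leaf k c) \<longleftrightarrow> False"
| "is_U (U i x) \<longleftrightarrow> True"
| "is_U (Comp i j x y) \<longleftrightarrow> False"

text \<open>The default 0 lies below the level of every composition vertex, as its indices are at
  least 1; leaves and units thus satisfy all bounds on children.\<close>

primrec mroot :: "'c tree \<Rightarrow> nat" where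
  "mroot (Leaf k c) = 0"
| "mroot (U i x) = 0"
| "mroot (Comp i j x y) = min i j"

primrec left_whisker :: "'c tree \<Rightarrow> bool" where
  "left_whisker (Leaf k c) \<longleftrightarrow> False"
| "left_whisker (U i x) \<longleftrightarrow> False"
| "left_whisker (Comp i j x y) \<longleftrightarrow> i < j"

primrec equal_root :: "'c tree \<Rightarrow> bool" where
  "equal_root (Leaf k c) \<longleftrightarrow> False"
| "equal_root (U i x) \<longleftrightarrow> False"
| "equal_root (Comp i j x y) \<longleftrightarrow> i = j"

text \<open>
  The conditions that \<open>normal_form\<close> imposes on single edges; those on the shape of components say
  which child may lie in the same component as its parent.
\<close>

primrec locally_normal :: "'c tree \<Rightarrow> bool" where
  "locally_normal (Leaf k c) \<longleftrightarrow> True"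
| "locally_normal (U i x) \<longleftrightarrow> locally_normal x"
| "locally_normal (Comp i j x y) \<longleftrightarrow> locally_normal x \<and> locally_normal y \<and> \<not> is_U x \<and> \<not> is_U y \<and>
     mroot x \<le> min i j \<and> mroot y \<le> min i j \<and>
     (i < j \<longrightarrow> mroot x < i) \<and> (j \<le> i \<longrightarrow> mroot y < j) \<and>
     (j < i \<longrightarrow> mroot x = j \<longrightarrow> \<not> left_whisker x)"

lemma subtree_at_append: "subtree_at x (v @ w) = Option.bind (subtree_at x v) (\<lambda>y. subtree_at y w)"
  by (induction x v rule: subtree_at.induct) auto

definition m_edge :: "'c tree \<Rightarrow> (vertex \<times> vertex) set" where
  "m_edge x = {(a, b). a \<in> comp_vertices x \<and> b \<in> comp_vertices x \<and> (edge a b \<or> edge b a) \<and>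
     m_val x a = m_val x b}"

text \<open>Reachability classes of \<open>m_edge\<close> are connected and maximal, so every
  composition vertex lies in a component to which \<open>normal_form\<close> applies.\<close>

lemma m_constant_component_m_edge:
  assumes v: "v \<in> comp_vertices x"
  shows "m_constant_component x ((m_edge x)\<^sup>* `` {v})" (is "m_constant_component x ?S")
proof -
  have sym: "sym ((m_edge x)\<^sup>*)"
    by (intro sym_rtrancl) (auto simp: sym_def m_edge_def)
  have S: "w \<in> comp_vertices x \<and> m_val x w = m_val x v" if "(v, w) \<in> (m_edge x)\<^sup>*" for w
    using that by (induction rule: rtrancl_induct) (auto simp: v m_edge_def)
  let ?R = "{(a, b). a \<in> ?S \<and> b \<in> ?S \<and> (edge a b \<or> edge b a)}"
  \<comment> \<open>A path from \<open>v\<close> never leaves the class of \<open>v\<close>, whereas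
    connectedness asks for paths inside the set.\<close>
  have path: "(v, w) \<in> ?R\<^sup>*" if "(v, w) \<in> (m_edge x)\<^sup>*" for w
    using that
  proof (induction rule: rtrancl_induct)
    case (step a b)
    then have "(v, b) \<in> (m_edge x)\<^sup>*" by (auto intro: rtrancl_into_rtrancl)
    moreover have "edge a b \<or> edge b a" using step.hyps(2) by (auto simp: m_edge_def)
    ultimately have "(a, b) \<in> ?R" using step.hyps(1) by simp
    then show ?case using step.IH by (rule rtrancl_into_rtrancl[rotated])
  qed simp
  have "sym (?R\<^sup>*)" by (intro sym_rtrancl) (auto simp: sym_def)
  then have conn: "connected_vertices ?S"
    unfolding connected_vertices_def
  proof (intro conjI ballI)
    fix a b assume "a \<in> ?S" "b \<in> ?S"
    then have "(v, a) \<in> ?R\<^sup>*" "(v, b) \<in> ?R\<^sup>*" using path by (simp_all only: Image_singleton_iff)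
    then show "(a, b) \<in> ?R\<^sup>*" using \<open>sym (?R\<^sup>*)\<close> by (meson rtrancl_trans symD)
  qed blast
  have "T = ?S" if T: "m_constant_connected x T" "?S \<subseteq> T" for T
  proof
    show "T \<subseteq> ?S"
    proof
      fix w assume "w \<in> T"
      with T have "(v, w) \<in> {(a, b). a \<in> T \<and> b \<in> T \<and> (edge a b \<or> edge b a)}\<^sup>*"
        by (auto simp: m_constant_connected_def connected_vertices_def)
      moreover have "{(a, b). a \<in> T \<and> b \<in> T \<and> (edge a b \<or> edge b a)} \<subseteq> m_edge x"
        using T(1) by (force simp: m_constant_connected_def m_edge_def)
      ultimately show "w \<in> ?S" using rtrancl_mono by blast
    qed
  qed (use T in simp)
  moreover have "m_constant_connected x ?S"
    unfolding m_constant_connected_def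
  proof (intro conjI ballI impI subsetI conn)
    show "a \<in> comp_vertices x" if "a \<in> ?S" for a
      using that S[of a] by (simp only: Image_singleton_iff)
    show "m_val x a = m_val x b" if "a \<in> ?S" "b \<in> ?S" for a b
      using that S[of a] S[of b] by (simp only: Image_singleton_iff)
  qed
  ultimately show ?thesis unfolding m_constant_component_def by blast
qed

lemma labelled_comp_unique: "labelled_comp x v i j \<Longrightarrow> labelled_comp x v i' j' \<Longrightarrow> i' = i \<and> j' = j"
  by (auto simp: labelled_comp_def)

text \<open>Addresses grow by one input per link, so their length determines the position in the
  chain; a parent and child in the chain are therefore consecutive.\<close>

lemma chain_successor:
  fixes v :: "nat \<Rightarrow> 'a list"
  assumes step: "\<And>l. l + 1 < N \<Longrightarrow> v (l + 1) = v l @ [d l]"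
    and "w \<in> v ` {..<N}" "w @ [e] \<in> v ` {..<N}"
  obtains l where "l + 1 < N" "v l = w" "v (l + 1) = w @ [e]" "d l = e"
proof -
  have len: "length (v l) = length (v 0) + l" if "l < N" for l
    using that by (induction l) (auto simp: step[simplified])
  obtain p q where pq: "p < N" "v p = w" "q < N" "v q = w @ [e]"
    using assms(2,3) by auto
  then have "q = p + 1" using len[of p] len[of q] by simp
  moreover from this pq have "p + 1 < N" by simp
  moreover have "d p = e" using step[OF \<open>p + 1 < N\<close>] pq \<open>q = p + 1\<close> by simp
  ultimately show ?thesis using pq that[of p] by simp
qed

text \<open>Parent and child of equal level share a component, hence are consecutive in its chain.
  The shape of the chain fixes the input, and after the switch to right whiskers only right whiskers
  follow.\<close>

lemma normal_form_same_m:
  assumes nf: "normal_form x"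
    and v: "labelled_comp x v i j" and w: "labelled_comp x (v @ [e]) i' j'"
    and m: "min i j = min i' j'"
  shows "(i < j \<longrightarrow> e = In_Right) \<and> (j \<le> i \<longrightarrow> e = In_Left) \<and> (j < i \<longrightarrow> j' < i')"
proof -
  define S where "S = (m_edge x)\<^sup>* `` {v}"
  have vw: "v \<in> comp_vertices x" "v @ [e] \<in> comp_vertices x"
    using v w by (auto simp: comp_vertices_def)
  have "m_val x v = m_val x (v @ [e])"
    using v w m unfolding labelled_comp_def m_val_def by fastforce
  then have "(v, v @ [e]) \<in> m_edge x" using vw by (auto simp: m_edge_def edge_def)
  then have S: "v \<in> S" "v @ [e] \<in> S" by (auto simp: S_def)
  have "mixed_chain x S \<or> equal_chain x S"
    using nf m_constant_component_m_edge[OF vw(1)] by (auto simp: normal_form_def S_def)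
  then show ?thesis
  proof
    assume "mixed_chain x S"
    then show ?thesis
      unfolding mixed_chain_def
    proof (elim exE conjE)
      fix p k a b and f :: "nat \<Rightarrow> vertex"
      assume "p < k" "1 \<le> a + b" "S = f ` {..<a + b}"
        "\<forall>l < a. labelled_comp x (f l) p k"
        "\<forall>l. a \<le> l \<and> l < a + b \<longrightarrow> labelled_comp x (f l) k p"
        "\<forall>l. l + 1 < a + b \<longrightarrow> f (l + 1) = f l @ [if l < a then In_Right else In_Left]"
      then have c: "p < k" "S = f ` {..<a + b}"
        "\<And>l. l < a \<Longrightarrow> labelled_comp x (f l) p k"
        "\<And>l. a \<le> l \<Longrightarrow> l < a + b \<Longrightarrow> labelled_comp x (f l) k p"
        "\<And>l. l + 1 < a + b \<Longrightarrow> f (l + 1) = f l @ [if l < a then In_Right else In_Left]"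
        by simp_all
      obtain l where l: "l + 1 < a + b" "f l = v" "f (l + 1) = v @ [e]"
        "(if l < a then In_Right else In_Left) = e"
        using chain_successor[where v = f and N = "a + b" and d = "\<lambda>l. if l < a then In_Right else In_Left", OF c(5)]
          S[unfolded c(2)] by metis
      show ?thesis
      proof (cases "l < a")
        case True
        then show ?thesis using c(1) c(3)[of l] l v by (auto dest: labelled_comp_unique)
      next
        case False
        then show ?thesis using c(1) c(4)[of l] c(4)[of "l + 1"] l v w
          by (auto dest: labelled_comp_unique)
      qed
    qed
  next
    assume "equal_chain x S"
    then show ?thesis
      unfolding equal_chain_def
    proof (elim exE conjE)
      fix k a and f :: "nat \<Rightarrow> vertex"
      assume "1 \<le> a" "S = f ` {..<a}"
        "\<forall>l < a. labelled_comp x (f l) k k" "\<forall>l. l + 1 < a \<longrightarrow> f (l + 1) = f l @ [In_Left]"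
      then have c: "S = f ` {..<a}" "\<And>l. l < a \<Longrightarrow> labelled_comp x (f l) k k"
        "\<And>l. l + 1 < a \<Longrightarrow> f (l + 1) = f l @ [In_Left]"
        by simp_all
      obtain l where l: "l + 1 < a" "f l = v" "f (l + 1) = v @ [e]" "In_Left = e"
        using chain_successor[where v = f and N = a and d = "\<lambda>_. In_Left", OF c(3)] S[unfolded c(1)] by metis
      then show ?thesis using c(2)[of l] v by (auto dest: labelled_comp_unique)
    qed
  qed
qed

lemma normal_form_child:
  assumes nf: "normal_form x" and v: "subtree_at x v = Some (Comp i j y z)"
    and w: "subtree_at x (v @ [e]) = Some t" and ij: "1 \<le> i" "1 \<le> j"
  shows "\<not> is_U t" "mroot t \<le> min i j"
    "mroot t = min i j \<Longrightarrow>
       (i < j \<longrightarrow> e = In_Right) \<and> (j \<le> i \<longrightarrow> e = In_Left) \<and> (j < i \<longrightarrow> \<not> left_whisker t)"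
proof -
  have v': "v \<in> comp_vertices x" "labelled_comp x v i j"
    using v by (auto simp: comp_vertices_def labelled_comp_def)
  have e: "edge (v @ [e]) v" by (simp add: edge_def)
  show "\<not> is_U t"
    using nf v' e w by (cases t) (auto simp: normal_form_def u_vertices_def)
  show "mroot t \<le> min i j"
  proof (cases t)
    case (Comp a b s u)
    then have "v @ [e] \<in> comp_vertices x" using w by (auto simp: comp_vertices_def labelled_comp_def)
    then have "m_val x (v @ [e]) \<le> m_val x v"
      using nf v' e by (auto simp: normal_form_def m_ordered_def)
    then show ?thesis using v w Comp by (simp add: m_val_def)
  qed auto
  show "(i < j \<longrightarrow> e = In_Right) \<and> (j \<le> i \<longrightarrow> e = In_Left) \<and> (j < i \<longrightarrow> \<not> left_whisker t)"
    if m: "mroot t = min i j"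
  proof (cases t)
    case (Comp a b s u)
    then have "labelled_comp x (v @ [e]) a b" using w by (auto simp: labelled_comp_def)
    from normal_form_same_m[OF nf v'(2) this] m Comp show ?thesis by auto
  qed (use m ij in auto)
qed

text \<open>Normality is stated by addresses in the whole tree \<open>x\<close>, so the induction
  runs over a subtree \<open>t\<close> at a varying address.\<close>

lemma normal_form_locally_normal_subtree:
  "normal_form x \<Longrightarrow> is_tree n X d t \<Longrightarrow> subtree_at x v = Some t \<Longrightarrow> locally_normal t"
proof (induction t arbitrary: v d)
  case (U i t)
  then show ?case using U.IH[of "d - 1" "v @ [In_U]"] by (auto simp: subtree_at_append)
next
  case (Comp i j y z)
  have y: "subtree_at x (v @ [In_Left]) = Some y" and z: "subtree_at x (v @ [In_Right]) = Some z"
    using Comp.prems by (auto simp: subtree_at_append)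
  have ij: "1 \<le> i" "1 \<le> j" using Comp.prems by auto
  note left = normal_form_child[OF Comp.prems(1,3) y ij]
  note right = normal_form_child[OF Comp.prems(1,3) z ij]
  have "locally_normal y" "locally_normal z" using Comp y z by auto
  moreover have "mroot y < i" if "i < j"
    using left(2,3) that by (cases "mroot y = min i j") auto
  moreover have "mroot z < j" if "j \<le> i"
    using right(2,3) that by (cases "mroot z = min i j") auto
  moreover have "\<not> left_whisker y" if "j < i" "mroot y = j"
    using left(3) that by auto
  ultimately show ?case using left(1,2) right(1,2) by simp
qed auto

lemma normal_form_locally_normal: "normal_form x \<Longrightarrow> is_tree n X d x \<Longrightarrow> locally_normal x"
  by (rule normal_form_locally_normal_subtree[of x n X d x "[]"]) auto

section \<open>Recovering a locally normal tree from its value\<close>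

text \<open>Levels do not decrease towards the root, so the root acts at the highest occupied level
  of the value. The value thereby reveals the kind of root: several atoms for equal indices,
  otherwise one atom whose highest non-empty level is \<open>mroot x\<close>.\<close>

lemma locally_normal_val_shape:
  assumes "is_tree n X d x" "locally_normal x" "\<not> is_U x"
  shows "fst (val x) = d \<and> snd (val x) \<noteq> [] \<and>
    (if equal_root x then 2 \<le> length (snd (val x))
     else \<exists>c L R. snd (val x) = [Atom c L R] \<and> (\<forall>p>mroot x. L p = [] \<and> R p = []) \<and>
       (0 < mroot x \<longrightarrow> L (mroot x) \<noteq> [] \<or> R (mroot x) \<noteq> []) \<and>
       (L (mroot x) \<noteq> [] \<longleftrightarrow> left_whisker x))"
  using assms
proof (induction rule: is_tree.induct)
  case (3 i j x y)
  have x: "val x = (i, snd (val x))" "snd (val x) \<noteq> []"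
    and y: "val y = (j, snd (val y))" "snd (val y) \<noteq> []"
    using 3 by (auto simp: prod_eq_iff)
  have single: "\<not> equal_root z" if "is_tree n X k z" "mroot z < k" for z k
    using that by (cases z) auto
  consider "i = j" | "i < j" | "j < i" by linarith
  then show ?case
  proof cases
    case 1
    have "val (Comp i j x y) = (i, snd (val x) @ snd (val y))"
      using 1 by (subst val.simps, subst x(1), subst y(1)) simp
    then show ?thesis using 1 x(2) y(2) by (auto simp: Suc_le_eq length_greater_0_conv[symmetric]
          simp del: length_greater_0_conv)
  next
    case 2
    have "\<not> equal_root y" using single[of j y] 3 2 by auto
    then obtain c L R where a: "snd (val y) = [Atom c L R]" "\<forall>p>mroot y. L p = [] \<and> R p = []"
      using 3 by auto
    then have "\<forall>p>i. L p = [] \<and> R p = []" using 3 2 by simp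
    moreover have "val (Comp i j x y) = (j, [lwhisk i (snd (val x)) (Atom c L R)])"
      using 2 by (subst val.simps, subst x(1), subst y(1)) (simp add: a)
    ultimately show ?thesis using 2 x(2) by simp
  next
    case gt: 3
    have "\<not> equal_root x" using single[of i x] 3 gt by auto
    then obtain c L R where a: "snd (val x) = [Atom c L R]" "\<forall>p>mroot x. L p = [] \<and> R p = []"
        "L (mroot x) \<noteq> [] \<longleftrightarrow> left_whisker x"
      using 3 by auto
    then have "\<forall>p>j. L p = [] \<and> R p = []" using 3 gt by simp
    \<comment> \<open>At root level \<open>j\<close>, \<open>x\<close> is not a left whisker; at a
      lower root level, \<open>j\<close> is an empty level.\<close>
    moreover have "L j = []" using 3 gt a by (cases "mroot x = j") auto
    moreover have "val (Comp i j x y) = (i, [rwhisk j (snd (val y)) (Atom c L R)])"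
      using gt by (subst val.simps, subst x(1), subst y(1)) (simp add: a)
    ultimately show ?thesis using gt y(2) by simp
  qed
qed auto

text \<open>Nothing lies above level \<open>m\<close> to recurse into, so only one list changes and
  the whisker can later be cancelled.\<close>

lemma lwhisk_top:
  assumes "\<And>p. m < p \<Longrightarrow> L p = []" "\<And>p. m < p \<Longrightarrow> R p = []"
  shows "lwhisk m l (Atom c L R) = Atom c (L(m := l @ L m)) R"
  using assms by (auto simp: fun_eq_iff)

lemma rwhisk_top:
  assumes "\<And>p. m < p \<Longrightarrow> L p = []" "\<And>p. m < p \<Longrightarrow> R p = []"
  shows "rwhisk m l (Atom c L R) = Atom c L (R(m := R m @ l))"
  using assms by (auto simp: fun_eq_iff)

lemma mroot_0_imp_Leaf: "is_tree n X d x \<Longrightarrow> mroot x = 0 \<Longrightarrow> \<not> is_U x \<Longrightarrow> \<exists>c. x = Leaf d c"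
  by (cases x) auto

lemma locally_normal_val_single:
  assumes "is_tree n X d x" "locally_normal x" "\<not> is_U x" "\<not> equal_root x"
  obtains c L R where "snd (val x) = [Atom c L R]" "\<And>p. mroot x < p \<Longrightarrow> L p = []"
    "\<And>p. mroot x < p \<Longrightarrow> R p = []" "0 < mroot x \<Longrightarrow> L (mroot x) \<noteq> [] \<or> R (mroot x) \<noteq> []"
    "L (mroot x) \<noteq> [] \<longleftrightarrow> left_whisker x"
proof -
  obtain c L R where "snd (val x) = [Atom c L R]" "\<forall>p>mroot x. L p = [] \<and> R p = []"
    "0 < mroot x \<longrightarrow> L (mroot x) \<noteq> [] \<or> R (mroot x) \<noteq> []"
    "L (mroot x) \<noteq> [] \<longleftrightarrow> left_whisker x"
    using locally_normal_val_shape[OF assms(1-3)] assms(4) by auto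
  then show ?thesis using that[of c L R] by simp
qed

lemma val_root_eq:
  assumes x: "is_tree n X d x" "locally_normal x" "\<not> is_U x" and y: "is_tree n X d y" "locally_normal y" "\<not> is_U y"
    and v: "val x = val y"
  shows "equal_root x = equal_root y \<and> (\<not> equal_root x \<longrightarrow> mroot x = mroot y \<and> left_whisker x = left_whisker y)"
proof -
  note sx = locally_normal_val_shape[OF x] and sy = locally_normal_val_shape[OF y]
  have eq: "equal_root x = equal_root y" using sx sy v by (auto split: if_splits)
  moreover have "mroot x = mroot y \<and> left_whisker x = left_whisker y" if ne: "\<not> equal_root x"
  proof -
    obtain c L R where a: "snd (val x) = [Atom c L R]" "\<forall>p>mroot x. L p = [] \<and> R p = []"
        "0 < mroot x \<longrightarrow> L (mroot x) \<noteq> [] \<or> R (mroot x) \<noteq> []"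
        "L (mroot x) \<noteq> [] \<longleftrightarrow> left_whisker x"
      using locally_normal_val_single[OF x ne] by metis
    then have b: "\<forall>p>mroot y. L p = [] \<and> R p = []"
        "0 < mroot y \<longrightarrow> L (mroot y) \<noteq> [] \<or> R (mroot y) \<noteq> []"
        "L (mroot y) \<noteq> [] \<longleftrightarrow> left_whisker y"
      using sy ne eq v by auto
    have "\<not> mroot x < mroot y" using a(2) b(2) by auto
    moreover have "\<not> mroot y < mroot x" using a(3) b(1) by auto
    ultimately have "mroot x = mroot y" by simp
    then show ?thesis using a(4) b(3) by simp
  qed
  ultimately show ?thesis by blast
qed

text \<open>Local normality makes one factor a single atom: \<open>x\<close> if
  \<open>i < j\<close>, and \<open>y\<close> otherwise. The list to which it contributes an end
  therefore splits in the same place on both sides.\<close>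

lemma val_Comp_inject:
  assumes x: "is_tree n X d (Comp i j x y)" "locally_normal (Comp i j x y)"
    and x': "is_tree n X d (Comp i j x' y')" "locally_normal (Comp i j x' y')"
    and v: "val (Comp i j x y) = val (Comp i j x' y')"
  shows "val x = val x' \<and> val y = val y'"
proof -
  have t: "is_tree n X i x" "is_tree n X j y" "is_tree n X i x'" "is_tree n X j y'"
    "locally_normal x" "locally_normal y" "locally_normal x'" "locally_normal y'"
    "\<not> is_U x" "\<not> is_U y" "\<not> is_U x'" "\<not> is_U y'"
    using x x' by auto
  note s = locally_normal_val_shape[OF t(1,5,9)] locally_normal_val_shape[OF t(2,6,10)]
    locally_normal_val_shape[OF t(3,7,11)] locally_normal_val_shape[OF t(4,8,12)]
  have d: "val x = (i, snd (val x))" "val y = (j, snd (val y))"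
    "val x' = (i, snd (val x'))" "val y' = (j, snd (val y'))"
    using s by (auto simp: prod_eq_iff)
  have single: "\<not> equal_root z" if "is_tree n X k z" "mroot z < k" for z k
    using that by (cases z) auto
  have eq: "vcomp (min i j) (i, snd (val x)) (j, snd (val y)) =
      vcomp (min i j) (i, snd (val x')) (j, snd (val y'))"
    using v by (simp flip: d)
  consider "i = j" | "i < j" | "j < i" by linarith
  then have "snd (val x) = snd (val x') \<and> snd (val y) = snd (val y')"
  proof cases
    case 1
    have "\<not> equal_root y" "\<not> equal_root y'" using single t x x' 1 by auto
    then have "length (snd (val y)) = length (snd (val y'))"
      using locally_normal_val_single[OF t(2,6,10)] locally_normal_val_single[OF t(4,8,12)]
      by (metis length_Cons list.size(3))
    then show ?thesis using eq 1 by simp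
  next
    case 2
    have e: "\<not> equal_root y" "\<not> equal_root y'" "\<not> equal_root x" "\<not> equal_root x'"
      using single[OF t(1)] single[OF t(2)] single[OF t(3)] single[OF t(4)] x x' 2 by auto
    obtain c L R where a: "snd (val y) = [Atom c L R]" "\<forall>p>mroot y. L p = [] \<and> R p = []"
      using locally_normal_val_single[OF t(2,6,10) e(1)] by metis
    obtain c' L' R' where a': "snd (val y') = [Atom c' L' R']" "\<forall>p>mroot y'. L' p = [] \<and> R' p = []"
      using locally_normal_val_single[OF t(4,8,12) e(2)] by metis
    obtain b b' where b: "snd (val x) = [b]" "snd (val x') = [b']"
      using locally_normal_val_single[OF t(1,5,9) e(3)] locally_normal_val_single[OF t(3,7,11) e(4)] by metis
    have above: "L p = []" "R p = []" "L' p = []" "R' p = []" if "i < p" for p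
      using a(2) a'(2) x x' 2 that by auto
    have *: "lwhisk i [b] (Atom c L R) = lwhisk i [b'] (Atom c' L' R')"
      using eq 2 by (simp add: a(1) a'(1) b)
    then have **: "c = c'" "L(i := b # L i) = L'(i := b' # L' i)" "R = R'"
      using lwhisk_top[of i L R] lwhisk_top[of i L' R'] above by auto
    then have "b # L i = b' # L' i" by (metis fun_upd_same)
    then have "b = b'" "L i = L' i" by auto
    moreover from this have "L p = L' p" for p
      using **(2) by (cases "p = i") (auto dest: fun_cong[of _ _ p])
    then have "L = L'" ..
    ultimately show ?thesis using ** by (simp add: a(1) a'(1) b)
  next
    case 3
    have e: "\<not> equal_root y" "\<not> equal_root y'" "\<not> equal_root x" "\<not> equal_root x'"
      using single[OF t(1)] single[OF t(2)] single[OF t(3)] single[OF t(4)] x x' 3 by auto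
    obtain c L R where a: "snd (val x) = [Atom c L R]" "\<forall>p>mroot x. L p = [] \<and> R p = []"
      using locally_normal_val_single[OF t(1,5,9) e(3)] by metis
    obtain c' L' R' where a': "snd (val x') = [Atom c' L' R']" "\<forall>p>mroot x'. L' p = [] \<and> R' p = []"
      using locally_normal_val_single[OF t(3,7,11) e(4)] by metis
    obtain b b' where b: "snd (val y) = [b]" "snd (val y') = [b']"
      using locally_normal_val_single[OF t(2,6,10) e(1)] locally_normal_val_single[OF t(4,8,12) e(2)] by metis
    have above: "L p = []" "R p = []" "L' p = []" "R' p = []" if "j < p" for p
      using a(2) a'(2) x x' 3 that by auto
    have *: "rwhisk j [b] (Atom c L R) = rwhisk j [b'] (Atom c' L' R')"
      using eq 3 by (simp add: a(1) a'(1) b)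
    then have **: "c = c'" "R(j := R j @ [b]) = R'(j := R' j @ [b'])" "L = L'"
      using rwhisk_top[of j L R] rwhisk_top[of j L' R'] above by auto
    then have "R j @ [b] = R' j @ [b']" by (metis fun_upd_same)
    then have "b = b'" "R j = R' j" by auto
    moreover from this have "R p = R' p" for p
      using **(2) by (cases "p = j") (auto dest: fun_cong[of _ _ p])
    then have "R = R'" ..
    ultimately show ?thesis using ** by (simp add: a(1) a'(1) b)
  qed
  then show ?thesis using d by metis
qed

text \<open>The dimension \<open>d\<close> supplies what the value forgets: the root is a unit
  exactly when \<open>fst (val x) < d\<close>. All other roots are determined by the value together
  with \<open>d\<close>.\<close>

lemma val_inject:
  assumes "is_tree n X d x" "is_tree n X d x'" "locally_normal x" "locally_normal x'" "val x = val x'"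
  shows "x = x'"
proof -
  have val_less: "fst (val y) < d" if "is_tree n X d y" "is_U y" for y d
    using that by (cases y) (auto dest: fst_val_le)
  show ?thesis
    using assms
  proof (induction x arbitrary: d x' rule: tree.induct)
    case (Leaf k c)
    have "\<not> is_U x'"
      using val_less[of d x'] Leaf.prems(1,2) Leaf.prems(5)[symmetric] by auto
    with Leaf have "mroot x' = 0 \<or> equal_root x'"
      using val_root_eq[of n X d "Leaf k c" x'] by auto
    moreover have "\<not> equal_root x'"
      using Leaf \<open>\<not> is_U x'\<close> val_root_eq[of n X d "Leaf k c" x'] by auto
    ultimately show ?case using Leaf \<open>\<not> is_U x'\<close> mroot_0_imp_Leaf[of n X d x'] by auto
  next
    case (U i x)
    have "fst (val x) < d" using val_less[of d "U i x"] U.prems by simp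
    then have "is_U x'" using U.prems locally_normal_val_shape[of n X d x'] by auto
    then show ?case using U by (cases x') auto
  next
    case (Comp i j x y)
    have "fst (val (Comp i j x y)) = d" using Comp.prems locally_normal_val_shape[of n X d "Comp i j x y"] by auto
    then have U: "\<not> is_U x'" using Comp.prems(2,5) val_less by (metis less_irrefl)
    have root: "equal_root (Comp i j x y) = equal_root x'"
      "\<not> equal_root x' \<Longrightarrow> mroot (Comp i j x y) = mroot x' \<and> left_whisker (Comp i j x y) = left_whisker x'"
      using val_root_eq[OF Comp.prems(1,3) _ Comp.prems(2,4) U Comp.prems(5)] by auto
    show ?case
    proof (cases x')
      case (Leaf k c)
      then show ?thesis using root Comp.prems(1) by auto
    next
      case (Comp a b u w)
      \<comment> \<open>The larger index is \<open>d\<close>. If the indices differ,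
        \<open>mroot\<close> gives the smaller one and \<open>left_whisker\<close> their
        order.\<close>
      have "a = i \<and> b = j"
        using root Comp Comp.prems(1,2) by (auto simp: min_def max_def split: if_splits)
      then show ?thesis
        using val_Comp_inject[of n X d i j x y u w] Comp Comp.prems Comp.IH by auto
    qed (use U in simp)
  qed
qed

theorem proposition4p12:
  fixes n :: nat and C :: "'c computad_data" and x x' :: "'c tree"
  assumes "is_computad n n C"
    and "compatible n C x" and "compatible n C x'"
    and "normal_form x" and "normal_form x'"
    and "sim n C x x'"
  shows "x = x'"
proof -
  have x: "is_tree n (cells C) (tdim x) x" "is_tree n (cells C) (tdim x') x'"
    using assms(2,3) by (auto dest: compatible_sim_val)
  have v: "tdim x = tdim x'" "val x = val x'"
    using assms(6) by (auto dest: compatible_sim_val)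
  show ?thesis
    by (rule val_inject[of n "cells C" "tdim x"])
      (use x v assms(4,5) in \<open>auto intro: normal_form_locally_normal\<close>)
qed

end
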